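(* Let $\mathfrak g$ be a Leibniz algebra (not necessarily finite dimensional) over a field $\mathbb K$ of characteristic $0$. Then the space $ALP^\bullet(\mathfrak g)$ of anti-cyclic cochains is a subcomplex of $(LP^\bullet(\mathfrak g),b_{LP})$; that is, $b_{LP}(ALP^n(\mathfrak g))\subseteq ALP^{n+1}(\mathfrak g)$ for all $n\ge0$.
   Context: A (left) Leibniz algebra is a vector space $\mathfrak g$ with a bilinear bracket satisfying $[x_1,[x_2,x_3]]=[[x_1,x_2],x_3]+[x_2,[x_1,x_3]]$. $\mathfrak g[1]$ is $\mathfrak g$ placed in degree $-1$ (so its elements are odd), with the same bracket $[x,y]$. $LP^n(\mathfrak g):=\mathrm{Hom}(\mathfrak g[1]^{\otimes n+1},\mathbb K)$ for $n\ge0$ (all $(n+1)$-linear functions), with coboundary $b_{LP}:LP^n(\mathfrak g)\to LP^{n+1}(\mathfrak g)$, $$(b_{LP}A)(x_1,\dots,x_{n+2})=(-1)^nA(x_1,\dots,x_n,[x_{n+1},x_{n+2}]+[x_{n+2},x_{n+1}])+\sum_{i<j,\ i\le n}(-1)^{i-1}A(x_1,\dots,\widehat{x_i},\dots,[x_i,x_j],x_{j+1},\dots,x_{n+2}),$$ where $\widehat{x_i}$ means omission and $[x_i,x_j]$ replaces $x_j$. Let $F_{Lie}\,\mathfrak g[1]$ be the free graded Lie algebra (Koszul signs) on $\mathfrak g[1]$ with bracket $(\cdot,\cdot)$, and $\{x_1,\dots,x_n\}:=(x_1,(x_2,(\dots,x_n)))$. Let $\epsilon:F_{Lie}\,\mathfrak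 g[1]\hookrightarrow\bigoplus_{n\ge1}\mathfrak g[1]^{\otimes n}$ be the graded commutator embedding: $\epsilon\{x_1\}=x_1$, $\epsilon\{x_1,\dots,x_n\}=x_1\otimes\epsilon\{x_2,\dots,x_n\}-(-1)^{n-1}\epsilon\{x_2,\dots,x_n\}\otimes x_1$. A cochain $A\in LP^n(\mathfrak g)$ is anti-cyclic if $$A(x_1,\dots,x_{n+1})=\tfrac1{n+1}A(\epsilon\{x_1,\dots,x_{n+1}\})\quad\text{for all }x_1,\dots,x_{n+1}.$$ $ALP^n(\mathfrak g)\subseteq LP^n(\mathfrak g)$ is the subspace of anti-cyclic $n$-cochains. *)

theory Defs
  imports Complex_Main "HOL-Library.Poly_Mapping"
begin

text \<open>
  The underlying vector space is the whole type \<open>'v\<close> with scalar multiplication \<open>scale\<close>; no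
  finiteness is assumed. A sequence \<open>x\<^sub>1, \<dots>, x\<^sub>m\<close> is
  a list, so \<open>x\<^sub>i\<close> is \<open>xs ! (i - 1)\<close>.
\<close>

locale leibniz_algebra = vector_space scale
  for scale :: "'k::field \<Rightarrow> 'v::ab_group_add \<Rightarrow> 'v" +
  fixes br :: "'v \<Rightarrow> 'v \<Rightarrow> 'v"
  assumes linear_right: "Vector_Spaces.linear scale scale (\<lambda>y. br x y)"
    and linear_left: "Vector_Spaces.linear scale scale (\<lambda>x. br x y)"
    and leibniz: "br x\<^sub>1 (br x\<^sub>2 x\<^sub>3) = br (br x\<^sub>1 x\<^sub>2) x\<^sub>3 + br x\<^sub>2 (br x\<^sub>1 x\<^sub>3)"

text \<open>
  An \<open>n\<close>-cochain is an \<open>(n + 1)\<close>-linear function. Being a function on all lists, it is normalised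
  to \<open>0\<close> on lists of any other length.
\<close>

definition LP :: "('k::field \<Rightarrow> 'v::ab_group_add \<Rightarrow> 'v) \<Rightarrow> nat \<Rightarrow> ('v list \<Rightarrow> 'k) set" where
  "LP scale n = {A.
     (\<forall>xs i. length xs = n + 1 \<longrightarrow> i < n + 1 \<longrightarrow>
        Vector_Spaces.linear scale (*) (\<lambda>v. A (xs[i := v]))) \<and>
     (\<forall>xs. length xs \<noteq> n + 1 \<longrightarrow> A xs = 0)}"

definition omit :: "nat \<Rightarrow> 'a list \<Rightarrow> 'a list" where
  "omit i xs = take i xs @ drop (Suc i) xs"

text \<open>
  The summation indices below start at \<open>0\<close>: they are the \<open>i - 1\<close> and \<open>j - 1\<close> of
  \<open>\<Sum>\<^sub>i\<^sub><\<^sub>j\<^sub>,\<^sub>i\<^sub>\<le>\<^sub>n (-1)\<^sup>i\<^sup>-\<^sup>1 A(x\<^sub>1, \<dots>, omit x\<^sub>i, \<dots>, [x\<^sub>i, x\<^sub>j], x\<^sub>j\<^sub>+\<^sub>1, \<dots>, x\<^sub>n\<^sub>+\<^sub>2)\<close>.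
\<close>

definition b_LP :: "('v::ab_group_add \<Rightarrow> 'v \<Rightarrow> 'v) \<Rightarrow> nat \<Rightarrow> ('v list \<Rightarrow> 'k::field) \<Rightarrow> 'v list \<Rightarrow> 'k" where
  "b_LP br n A xs =
     (if length xs = n + 2 then
        (-1) ^ n * A (take n xs @ [br (xs ! n) (xs ! (n + 1)) + br (xs ! (n + 1)) (xs ! n)]) +
        (\<Sum>i<n. \<Sum>j\<in>{i<..<n + 2}. (-1) ^ i * A (omit i (xs[j := br (xs ! i) (xs ! j)])))
      else 0)"

text \<open>
  Elements of the tensor algebra are represented by formal linear combinations of words, the word
  \<open>[x\<^sub>1, \<dots>, x\<^sub>m]\<close> standing for \<open>x\<^sub>1 \<otimes> \<dots> \<otimes> x\<^sub>m\<close>. The relations making the tensor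
  product multilinear are not divided out: a cochain, extended linearly to formal combinations by
  \<open>apply_tensor\<close>, takes the same value on all representatives of a tensor
  (\<open>apply_tensor_add\<close> and \<open>apply_tensor_relation\<close>).
\<close>

definition tensor :: "('v list \<Rightarrow>\<^sub>0 'k::field) \<Rightarrow> ('v list \<Rightarrow>\<^sub>0 'k) \<Rightarrow> ('v list \<Rightarrow>\<^sub>0 'k)" where
  "tensor p q = (\<Sum>u\<in>Poly_Mapping.keys p. \<Sum>w\<in>Poly_Mapping.keys q.
     Poly_Mapping.single (u @ w) (Poly_Mapping.lookup p u * Poly_Mapping.lookup q w))"

definition apply_tensor :: "('v list \<Rightarrow> 'k::field) \<Rightarrow> ('v list \<Rightarrow>\<^sub>0 'k) \<Rightarrow> 'k" where
  "apply_tensor A p = (\<Sum>w\<in>Poly_Mapping.keys p. Poly_Mapping.lookup p w * A w)"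

lemma apply_tensor_single: "apply_tensor A (Poly_Mapping.single w c) = c * A w"
  by (simp add: apply_tensor_def)

lemma apply_tensor_superset:
  assumes "finite S" "Poly_Mapping.keys p \<subseteq> S"
  shows "apply_tensor A p = (\<Sum>w\<in>S. Poly_Mapping.lookup p w * A w)"
  unfolding apply_tensor_def
  by (rule sum.mono_neutral_left) (use assms in \<open>auto simp: in_keys_iff\<close>)

lemma apply_tensor_add: "apply_tensor A (p + q) = apply_tensor A p + apply_tensor A q"
proof -
  let ?S = "Poly_Mapping.keys p \<union> Poly_Mapping.keys q"
  have "apply_tensor A (p + q) = (\<Sum>w\<in>?S. Poly_Mapping.lookup (p + q) w * A w)"
    by (rule apply_tensor_superset) (auto dest: subsetD[OF Poly_Mapping.keys_add])
  moreover have "apply_tensor A p = (\<Sum>w\<in>?S. Poly_Mapping.lookup p w * A w)"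
    and "apply_tensor A q = (\<Sum>w\<in>?S. Poly_Mapping.lookup q w * A w)"
    by (rule apply_tensor_superset; simp)+
  ultimately show ?thesis
    by (simp add: lookup_add distrib_right sum.distrib)
qed

lemma apply_tensor_relation:
  assumes "A \<in> LP scale n" "length xs = n + 1" "i < n + 1"
  shows "apply_tensor A (Poly_Mapping.single (xs[i := scale c u + v]) d) =
         apply_tensor A (Poly_Mapping.single (xs[i := u]) (d * c) +
                         Poly_Mapping.single (xs[i := v]) d)"
proof -
  have "Vector_Spaces.linear scale (*) (\<lambda>v. A (xs[i := v]))"
    using assms by (simp add: LP_def)
  then have mh: "module_hom scale (*) (\<lambda>v. A (xs[i := v]))"
    by (rule Vector_Spaces.linear.axioms(3))
  have "A (xs[i := scale c u + v]) = c * A (xs[i := u]) + A (xs[i := v])"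
    using module_hom.add[OF mh, of "scale c u" v] module_hom.scale[OF mh, of c u] by simp
  then show ?thesis
    by (simp only: apply_tensor_add apply_tensor_single distrib_left mult.assoc)
qed

text \<open>
  \<open>eps [x\<^sub>1, \<dots>, x\<^sub>m]\<close> is the image \<open>\<epsilon>{x\<^sub>1, \<dots>, x\<^sub>m}\<close> of the right-nested bracket
  \<open>(x\<^sub>1, (x\<^sub>2, (\<dots>, x\<^sub>m)))\<close> of the free graded Lie algebra under the graded commutator embedding. The
  generators are odd, so \<open>{x\<^sub>2, \<dots>, x\<^sub>m}\<close> has the parity of \<open>m - 1\<close>, which is the length of \<open>y # ys\<close>
  below. The value on the empty list is never used.
\<close>

fun eps :: "'v list \<Rightarrow> ('v list \<Rightarrow>\<^sub>0 'k::field)" where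
  "eps [] = 0"
| "eps [x] = Poly_Mapping.single [x] 1"
| "eps (x # y # ys) =
     tensor (Poly_Mapping.single [x] 1) (eps (y # ys)) -
     Poly_Mapping.map ((*) ((-1) ^ length (y # ys)))
       (tensor (eps (y # ys)) (Poly_Mapping.single [x] 1))"

definition ALP :: "('k::field \<Rightarrow> 'v::ab_group_add \<Rightarrow> 'v) \<Rightarrow> nat \<Rightarrow> ('v list \<Rightarrow> 'k) set" where
  "ALP scale n = {A \<in> LP scale n.
     \<forall>xs. length xs = n + 1 \<longrightarrow> A xs = 1 / of_nat (n + 1) * apply_tensor A (eps xs)}"

end

theory Submission
  imports Defs
begin

text \<open>
  Write \<open>D\<close> for the operator \<open>x\<^sub>1 \<otimes> \<dots> \<otimes> x\<^sub>m \<mapsto> \<epsilon>{x\<^sub>1, \<dots>, x\<^sub>m}\<close> on tensors. The coboundary is dual to an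
  operator \<open>b\<close> lowering tensor degree by one, so the claim is \<open>A (b (D w)) = m A (b w)\<close> for words \<open>w\<close> of length
  \<open>m\<close>, and as \<open>A\<close> is a multiple of \<open>A \<circ> D\<close> it suffices that \<open>E = D \<circ> b\<close> satisfies \<open>E (D w) = m E w\<close>. Let
  \<open>L\<^sub>x\<close> be the derivation of the tensor algebra extending \<open>y \<mapsto> [x, y]\<close>, and \<open>L\<^sub>P = 0\<close> for \<open>P\<close> of degree at least
  two. Then \<open>E\<close> descends to an operator \<open>\<delta>\<close> on the free graded Lie algebra, which is a second order operator:
  \<open>\<delta> (P, Q) = (\<delta> P, Q) + (-1)\<^sup>p (P, \<delta> Q) + L\<^sub>P Q - (-1)\<^sup>p\<^sup>q L\<^sub>Q P\<close>, where \<open>p\<close>, \<open>q\<close> are the degrees of \<open>P\<close>, \<open>Q\<close>.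
  This identity is proved with \<open>P = D w\<close> and \<open>Q = D v\<close> by induction on \<open>w\<close>, and together with the
  Dynkin--Specht--Wever identity \<open>D (D w) = m D w\<close> it yields the claim.
\<close>

text \<open>Concatenation makes words a monoid, hence their formal linear combinations a ring: the tensor algebra.\<close>

instantiation list :: (type) monoid_add
begin

definition zero_list :: "'a list" where "0 = []"

definition plus_list :: "'a list \<Rightarrow> 'a list \<Rightarrow> 'a list" where "xs + ys = xs @ ys"

instance
  by standard (simp_all add: zero_list_def plus_list_def)

end

abbreviation word :: "'v list \<Rightarrow> 'v list \<Rightarrow>\<^sub>0 'k::field" where
  "word w \<equiv> Poly_Mapping.single w 1"

abbreviation scalar :: "'k \<Rightarrow> 'v list \<Rightarrow>\<^sub>0 'k::field" where
  "scalar c \<equiv> Poly_Mapping.single [] c"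

lemma one_eq_word_Nil: "(1 :: 'v list \<Rightarrow>\<^sub>0 'k::field) = word []"
  unfolding zero_list_def[symmetric] by simp

lemma word_append: "(word (u @ v) :: 'v list \<Rightarrow>\<^sub>0 'k::field) = word u * word v"
  by (simp add: mult_single plus_list_def)

lemma word_Cons: "(word (x # v) :: 'v list \<Rightarrow>\<^sub>0 'k::field) = word [x] * word v"
  using word_append[of "[x]" v] by simp

lemma scalar_mult_word: "scalar c * word w = Poly_Mapping.single w (c::'k::field)"
  by (simp add: mult_single plus_list_def)

lemma poly_mapping_add_induct [case_names zero add]:
  assumes "P 0"
    and "\<And>w c p. P p \<Longrightarrow> P (Poly_Mapping.single w (c::'k::field) + p)"
  shows "P (p :: 'v list \<Rightarrow>\<^sub>0 'k)"
proof (induction p rule: update_induct)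
  case const
  show ?case by fact
next
  case (update f a b)
  have "Poly_Mapping.update a b f = Poly_Mapping.single a b + f"
    using update.hyps(1)
    by (intro poly_mapping_eqI)
       (auto simp: lookup_update lookup_add lookup_single in_keys_iff when_def)
  with update.IH assms(2) show ?case by metis
qed

lemma scalar_commute: "scalar c * p = p * scalar (c::'k::field)"
  by (induction p rule: poly_mapping_add_induct)
     (simp_all add: distrib_left distrib_right mult_single plus_list_def mult.commute)

text \<open>\<open>tensor\<close> is the convolution product of polynomial mappings over the
  concatenation monoid; this turns the graded commutators in \<open>eps\<close> into ring
  expressions.\<close>

lemma tensor_eq_mult: "tensor p q = p * (q :: 'v list \<Rightarrow>\<^sub>0 'k::field)"
proof -
  have sum_keys: "p = (\<Sum>u\<in>Poly_Mapping.keys p. Poly_Mapping.single u (Poly_Mapping.lookup p u))"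
    for p :: "'v list \<Rightarrow>\<^sub>0 'k"
    by (rule poly_mapping_eqI)
       (auto simp: lookup_sum lookup_single when_def in_keys_iff sum.delta')
  have "p * q =
    (\<Sum>u\<in>Poly_Mapping.keys p. Poly_Mapping.single u (Poly_Mapping.lookup p u)) *
    (\<Sum>w\<in>Poly_Mapping.keys q. Poly_Mapping.single w (Poly_Mapping.lookup q w))"
    by (rule arg_cong2[OF sum_keys sum_keys])
  then show ?thesis
    by (simp add: tensor_def sum_product mult_single plus_list_def)
qed

section \<open>Linear operators on the tensor algebra\<close>

text \<open>Scalars are multiples of the empty word, which are central, so homogeneity is phrased as
  commuting with left multiplication by them.\<close>

definition tensor_linear :: "(('v list \<Rightarrow>\<^sub>0 'k::field) \<Rightarrow> ('v list \<Rightarrow>\<^sub>0 'k)) \<Rightarrow> bool" where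
  "tensor_linear F \<longleftrightarrow>
     (\<forall>p q. F (p + q) = F p + F q) \<and> (\<forall>c p. F (scalar c * p) = scalar c * F p)"

lemma tensor_linear_addD: "tensor_linear F \<Longrightarrow> F (p + q) = F p + F q"
  and tensor_linear_scalarD: "tensor_linear F \<Longrightarrow> F (scalar c * p) = scalar c * F p"
  by (simp_all add: tensor_linear_def)

lemma tensor_linear_0: "tensor_linear F \<Longrightarrow> F 0 = 0"
  using tensor_linear_scalarD[of F 0 0] by simp

lemma tensor_linear_uminus: "tensor_linear F \<Longrightarrow> F (- p) = - F p"
  using tensor_linear_addD[of F p "- p"] tensor_linear_0[of F] by (simp add: eq_neg_iff_add_eq_0 add.commute)

lemma tensor_linear_diff: "tensor_linear F \<Longrightarrow> F (p - q) = F p - F q"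
  using tensor_linear_addD[of F p "- q"] tensor_linear_uminus[of F q] by simp

text \<open>Signs and integer factors occur below as the ring elements \<open>(-1) ^ k\<close> and
  \<open>of_nat k\<close> rather than as \<open>scalar\<close>; hence this rule and the
  next.\<close>

lemma tensor_linear_sign: "tensor_linear F \<Longrightarrow> F ((-1) ^ k * p) = (-1) ^ k * F p"
  by (cases "even k") (simp_all add: tensor_linear_uminus)

lemma tensor_linear_of_nat: "tensor_linear F \<Longrightarrow> F (of_nat k * p) = of_nat k * F p"
  by (induction k) (simp_all add: tensor_linear_0 tensor_linear_addD distrib_right)

lemmas tensor_linear_rules =
  tensor_linear_0 tensor_linear_addD tensor_linear_uminus tensor_linear_diff
  tensor_linear_sign tensor_linear_of_nat

lemma tensor_linear_id: "tensor_linear (\<lambda>p. p)"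
  and tensor_linear_zero: "tensor_linear (\<lambda>p. 0)"
  by (simp_all add: tensor_linear_def)

lemma tensor_linear_add: "tensor_linear F \<Longrightarrow> tensor_linear G \<Longrightarrow> tensor_linear (\<lambda>p. F p + G p)"
  by (simp add: tensor_linear_def distrib_left)

lemma tensor_linear_minus: "tensor_linear F \<Longrightarrow> tensor_linear G \<Longrightarrow> tensor_linear (\<lambda>p. F p - G p)"
  by (simp add: tensor_linear_def right_diff_distrib)

lemma tensor_linear_mult_left: "tensor_linear F \<Longrightarrow> tensor_linear (\<lambda>p. a * F p)"
proof -
  assume F: "tensor_linear F"
  have "a * (scalar c * F p) = scalar c * (a * F p)" for c p
    by (metis mult.assoc scalar_commute)
  with F show ?thesis by (simp add: tensor_linear_def distrib_left)
qed

lemma tensor_linear_mult_right: "tensor_linear F \<Longrightarrow> tensor_linear (\<lambda>p. F p * a)"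
  by (simp add: tensor_linear_def distrib_right mult.assoc)

lemma tensor_linear_compose: "tensor_linear F \<Longrightarrow> tensor_linear G \<Longrightarrow> tensor_linear (\<lambda>p. F (G p))"
  by (simp add: tensor_linear_def)

definition extend :: "('v list \<Rightarrow> ('v list \<Rightarrow>\<^sub>0 'k::field)) \<Rightarrow> ('v list \<Rightarrow>\<^sub>0 'k) \<Rightarrow> ('v list \<Rightarrow>\<^sub>0 'k)" where
  "extend f p = (\<Sum>w\<in>Poly_Mapping.keys p. scalar (Poly_Mapping.lookup p w) * f w)"

lemma extend_superset:
  assumes "finite S" "Poly_Mapping.keys p \<subseteq> S"
  shows "extend f p = (\<Sum>w\<in>S. scalar (Poly_Mapping.lookup p w) * f w)"
  unfolding extend_def
  by (rule sum.mono_neutral_left) (use assms in \<open>auto simp: in_keys_iff\<close>)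

lemma extend_single: "extend f (Poly_Mapping.single w c) = scalar c * f w"
  by (simp add: extend_def)

lemma extend_word [simp]: "extend f (word w) = f w"
  by (simp add: extend_single one_eq_word_Nil[symmetric])

lemma tensor_linear_extend: "tensor_linear (extend f)"
proof -
  have add: "extend f (p + q) = extend f p + extend f q" for p q
  proof -
    let ?S = "Poly_Mapping.keys p \<union> Poly_Mapping.keys q"
    have "extend f (p + q) = (\<Sum>w\<in>?S. scalar (Poly_Mapping.lookup (p + q) w) * f w)"
      by (rule extend_superset) (auto dest: subsetD[OF Poly_Mapping.keys_add])
    moreover have "extend f p = (\<Sum>w\<in>?S. scalar (Poly_Mapping.lookup p w) * f w)"
      and "extend f q = (\<Sum>w\<in>?S. scalar (Poly_Mapping.lookup q w) * f w)"
      by (rule extend_superset; simp)+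
    ultimately show ?thesis
      by (simp add: lookup_add single_add distrib_right sum.distrib)
  qed
  moreover have "extend f (scalar c * p) = scalar c * extend f p" for c p
    by (induction p rule: poly_mapping_add_induct)
       (simp_all add: add extend_single distrib_left mult_single plus_list_def
          mult.assoc[symmetric], simp add: extend_def)
  ultimately show ?thesis by (simp add: tensor_linear_def)
qed

lemmas tensor_linear_intros =
  tensor_linear_id tensor_linear_zero tensor_linear_add tensor_linear_minus
  tensor_linear_mult_left tensor_linear_mult_right
  tensor_linear_extend tensor_linear_compose[OF tensor_linear_extend]

lemmas extend_rules = tensor_linear_rules[OF tensor_linear_extend]

text \<open>Words form a basis. Testing only words in the support of \<open>p\<close> makes their
  length available when \<open>p\<close> is homogeneous.\<close>

lemma tensor_linear_eqI:
  assumes "tensor_linear F" "tensor_linear G"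
    and "\<And>w. w \<in> Poly_Mapping.keys p \<Longrightarrow> F (word w) = G (word w)"
  shows "F p = G p"
proof -
  have expand: "F p = extend (\<lambda>w. F (word w)) p" if F: "tensor_linear F" for F
  proof (induction p rule: poly_mapping_add_induct)
    case (add w c p)
    have "F (Poly_Mapping.single w c) = scalar c * F (word w)"
      by (simp only: tensor_linear_scalarD[OF F] flip: scalar_mult_word[of c w])
    with add show ?case
      by (simp add: tensor_linear_addD[OF F] extend_rules extend_single)
  qed (simp add: extend_rules tensor_linear_0[OF F])
  show ?thesis
    unfolding expand[OF assms(1)] expand[OF assms(2)] extend_def
    by (rule sum.cong) (simp_all add: assms(3))
qed

lemma extend_extend: "extend f (extend g p) = extend (\<lambda>w. extend f (g w)) p"
  by (rule tensor_linear_eqI[of _ _ p]) ((intro tensor_linear_intros)+, simp)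

section \<open>Evaluation of cochains on tensors\<close>

lemma apply_tensor_0: "apply_tensor A 0 = 0"
  by (simp add: apply_tensor_def)

lemma apply_tensor_diff: "apply_tensor A (p - q) = apply_tensor A p - apply_tensor A q"
  using apply_tensor_add[of A "p - q" q] by simp

lemma apply_tensor_of_nat: "apply_tensor A (of_nat k * p) = of_nat k * apply_tensor A p"
  by (induction k) (simp_all add: apply_tensor_0 apply_tensor_add distrib_right)

lemma apply_tensor_scalar_mult: "apply_tensor A (scalar c * p) = c * apply_tensor A p"
  by (induction p rule: poly_mapping_add_induct)
     (simp_all add: apply_tensor_0 apply_tensor_add apply_tensor_single distrib_left
        mult_single plus_list_def)

lemma apply_tensor_extend: "apply_tensor A (extend f p) = apply_tensor (\<lambda>w. apply_tensor A (f w)) p"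
  by (induction p rule: poly_mapping_add_induct)
     (simp_all add: apply_tensor_0 apply_tensor_add apply_tensor_single apply_tensor_scalar_mult
        extend_rules extend_single)

lemma apply_tensor_letter_mult: "apply_tensor A (word [y] * p) = apply_tensor (\<lambda>w. A (y # w)) p"
  by (induction p rule: poly_mapping_add_induct)
     (simp_all add: apply_tensor_0 apply_tensor_add apply_tensor_single distrib_left
        mult_single plus_list_def)

section \<open>The grading by word length\<close>

definition of_length :: "nat \<Rightarrow> ('v list \<Rightarrow>\<^sub>0 'k::field) \<Rightarrow> bool" where
  "of_length k p \<longleftrightarrow> (\<forall>w\<in>Poly_Mapping.keys p. length w = k)"

lemma of_length_0: "of_length k 0"
  and of_length_word: "length w = k \<Longrightarrow> of_length k (word w)"
  by (simp_all add: of_length_def)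

lemma of_length_add: "of_length k p \<Longrightarrow> of_length k q \<Longrightarrow> of_length k (p + q)"
  using Poly_Mapping.keys_add[of p q] by (auto simp: of_length_def)

lemma of_length_uminus: "of_length k p \<Longrightarrow> of_length k (- p)"
  by (simp add: of_length_def in_keys_iff)

lemma of_length_diff: "of_length k p \<Longrightarrow> of_length k q \<Longrightarrow> of_length k (p - q)"
  using of_length_add[of k p "- q"] of_length_uminus[of k q] by simp

lemma of_length_sign: "of_length k p \<Longrightarrow> of_length k ((-1) ^ m * p)"
  by (cases "even m") (simp_all add: of_length_uminus)

lemma of_length_mult: "of_length k p \<Longrightarrow> of_length l q \<Longrightarrow> of_length (k + l) (p * q)"
  using keys_mult[of p q] by (fastforce simp: of_length_def plus_list_def)

lemma of_length_letter_mult: "of_length k p \<Longrightarrow> of_length (Suc k) (word [y] * p)"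
  using of_length_mult[OF of_length_word[of "[y]" 1], of k p] by simp

lemma of_length_mult_letter: "of_length k p \<Longrightarrow> of_length (Suc k) (p * word [y])"
  using of_length_mult[OF _ of_length_word[of "[y]" 1], of k p] by simp

lemma of_length_extend:
  assumes "of_length k p" "\<And>w. length w = k \<Longrightarrow> of_length m (f w)"
  shows "of_length m (extend f p)"
proof -
  have "of_length m (\<Sum>w\<in>S. scalar (Poly_Mapping.lookup p w) * f w)"
    if "finite S" "S \<subseteq> Poly_Mapping.keys p" for S
    using that
  proof (induction S)
    case (insert w S)
    then have "of_length (0 + m) (scalar (Poly_Mapping.lookup p w) * f w)"
      using assms by (intro of_length_mult) (auto simp: of_length_def split: if_splits)
    with insert show ?case by (simp add: of_length_add)
  qed (simp add: of_length_0)
  then show ?thesis by (simp add: extend_def)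
qed

section \<open>The operator D and the Dynkin-Specht-Wever identity\<close>

lemma eps_Cons:
  assumes "w \<noteq> []"
  shows "(eps (y # w) :: 'v list \<Rightarrow>\<^sub>0 'k::field) =
    word [y] * eps w - (-1) ^ length w * (eps w * word [y])"
proof -
  have "(scalar ((-1) ^ m) :: 'v list \<Rightarrow>\<^sub>0 'k) = (-1) ^ m" for m
    by (cases "even m") (simp_all add: single_uminus flip: one_eq_word_Nil)
  then show ?thesis
    using assms by (cases w) (simp_all add: tensor_eq_mult mult_map_scale_conv_mult zero_list_def single_uminus)
qed

lemma of_length_eps: "of_length (length w) (eps w :: 'v list \<Rightarrow>\<^sub>0 'k::field)"
proof (induction w)
  case (Cons y w)
  show ?case
  proof (cases "w = []")
    case False
    with Cons show ?thesis
      by (simp add: eps_Cons of_length_diff of_length_sign of_length_letter_mult of_length_mult_letter)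
  qed (simp add: of_length_word)
qed (simp add: of_length_0)

text \<open>The sign in \<open>eps\<close> depends on the length of the word, so the recursion is
  lifted to homogeneous tensors. Degree 0 is excluded because \<open>eps [y]\<close> is not a
  commutator.\<close>

lemma extend_eps_letter_mult:
  assumes "of_length k p" "k > 0"
  shows "extend eps (word [y] * p) =
    word [y] * extend eps p - (-1) ^ k * (extend eps p * (word [y] :: 'v list \<Rightarrow>\<^sub>0 'k::field))"
proof (rule tensor_linear_eqI[of _ _ p])
  fix w assume "w \<in> Poly_Mapping.keys p"
  with assms have "length w = k" by (auto simp: of_length_def)
  moreover from this assms have "w \<noteq> []" by auto
  ultimately show "extend eps (word [y] * word w) =
    word [y] * extend eps (word w) - (-1) ^ k * (extend eps (word w) * (word [y] :: 'v list \<Rightarrow>\<^sub>0 'k))"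
    by (simp add: eps_Cons flip: word_Cons)
qed (intro tensor_linear_intros)+

text \<open>Under D a leading letter acts as the bracket with that letter; by the graded Jacobi
  identity a leading \<open>D w\<close> then acts as the bracket with \<open>D w\<close>. The word
  \<open>v\<close> varies because \<open>D w \<otimes> y\<close> moves \<open>y\<close> in front of
  \<open>v\<close>.\<close>

lemma extend_eps_mult_word:
  assumes "w \<noteq> []" "v \<noteq> []"
  shows "extend eps (eps w * word v) =
    eps w * eps v - (-1) ^ (length w * length v) * (eps v * (eps w :: 'v list \<Rightarrow>\<^sub>0 'k::field))"
  using assms
proof (induction w arbitrary: v)
  case (Cons y w)
  show ?case
  proof (cases "w = []")
    case True
    with Cons.prems show ?thesis by (simp add: eps_Cons flip: word_Cons)
  next
    case False
    have len: "of_length (length w + length v) (eps w * word v :: 'v list \<Rightarrow>\<^sub>0 'k)"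
      by (intro of_length_mult of_length_eps of_length_word refl)
    have "extend eps (eps (y # w) * word v :: 'v list \<Rightarrow>\<^sub>0 'k) =
      extend eps (word [y] * (eps w * word v)) - (-1) ^ length w * extend eps (eps w * word (y # v))"
      using False by (simp add: eps_Cons left_diff_distrib extend_rules word_Cons[of y v] mult.assoc)
    \<comment> \<open>Once the parities are fixed, all signs are \<open>1\<close> or
      \<open>-1\<close> and the graded Jacobi identity remains.\<close>
    also have "\<dots> = eps (y # w) * eps v - (-1) ^ (length (y # w) * length v) * (eps v * eps (y # w))"
      using False Cons.prems
      by (cases "even (length w)"; cases "even (length v)")
         (simp_all add: extend_eps_letter_mult[OF len] Cons.IH eps_Cons algebra_simps)
    finally show ?thesis .
  qed
qed simp

text \<open>Dynkin-Specht-Wever: with \<open>m = length w\<close>, D maps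
  \<open>y \<otimes> D w\<close> to \<open>m\<close> times \<open>eps (y # w)\<close> by induction,
  and the other half of the commutator yields one more copy by
  \<open>extend_eps_mult_word\<close>.\<close>

lemma extend_eps_eps:
  "extend eps (eps w) = of_nat (length w) * (eps w :: 'v list \<Rightarrow>\<^sub>0 'k::field)"
proof (induction w)
  case (Cons y w)
  show ?case
  proof (cases "w = []")
    case False
    have comm: "word [y] * (of_nat (length w) * p) = of_nat (length w) * (word [y] * p)"
      for p :: "'v list \<Rightarrow>\<^sub>0 'k"
      by (metis mult.assoc mult_of_nat_commute)
    have "length w > 0" using False by simp
    with False Cons show ?thesis
      by (cases "even (length w)")
         (simp_all add: eps_Cons extend_rules extend_eps_letter_mult[OF of_length_eps]
           extend_eps_mult_word comm algebra_simps)
  qed simp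
qed (simp add: extend_rules)

section \<open>The operator dual to the coboundary\<close>

context
  fixes br :: "'v \<Rightarrow> 'v \<Rightarrow> 'v"
begin

text \<open>An even derivation: passing a letter costs no Koszul sign.\<close>

primrec left_act_word :: "'v \<Rightarrow> 'v list \<Rightarrow> ('v list \<Rightarrow>\<^sub>0 'k::field)" where
  "left_act_word x [] = 0"
| "left_act_word x (y # w) = word (br x y # w) + word [y] * left_act_word x w"

definition left_act :: "'v \<Rightarrow> ('v list \<Rightarrow>\<^sub>0 'k::field) \<Rightarrow> ('v list \<Rightarrow>\<^sub>0 'k)" where
  "left_act x = extend (left_act_word x)"

text \<open>This is \<open>L_P\<close> for \<open>P = D w\<close>; a single letter is its own image
  under D.\<close>

definition word_act :: "'v list \<Rightarrow> ('v list \<Rightarrow>\<^sub>0 'k::field) \<Rightarrow> ('v list \<Rightarrow>\<^sub>0 'k)" where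
  "word_act w p = (if length w = 1 then left_act (hd w) p else 0)"

text \<open>
  The terms for \<open>i = 1\<close> of the coboundary are dual to \<open>left_act_word y w\<close>, those for \<open>i > 1\<close> to the
  recursive call. The last summand is nonzero only on words \<open>[y, z]\<close>, where it adds the letter \<open>[z, y]\<close>
  to the letter \<open>[y, z]\<close> coming from \<open>left_act_word\<close>.
\<close>

primrec boundary :: "'v list \<Rightarrow> ('v list \<Rightarrow>\<^sub>0 'k::field)" where
  "boundary [] = 0"
| "boundary (y # w) =
     (if w = [] then 0 else left_act_word y w - word [y] * boundary w + word_act w (word [y]))"

definition eps_boundary :: "'v list \<Rightarrow> ('v list \<Rightarrow>\<^sub>0 'k::field)" where
  "eps_boundary w = extend eps (boundary w)"

lemma tensor_linear_left_act: "tensor_linear (left_act x)"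
  by (simp add: left_act_def tensor_linear_extend)

lemmas left_act_rules = tensor_linear_rules[OF tensor_linear_left_act]

lemma left_act_word_append:
  "left_act_word x (u @ v) = left_act_word x u * word v + word u * left_act_word x v"
proof (induction u)
  case Nil
  then show ?case by (simp flip: one_eq_word_Nil)
next
  case (Cons y u)
  have "(word (br x y # u @ v) :: 'v list \<Rightarrow>\<^sub>0 'k::field) = word (br x y # u) * word v"
    using word_append[of "br x y # u" v] by simp
  with Cons show ?case
    by (simp add: word_Cons[of y u] algebra_simps)
qed

lemma left_act_mult:
  "left_act x (p * q) = left_act x p * q + p * (left_act x q :: 'v list \<Rightarrow>\<^sub>0 'k::field)"
proof (rule tensor_linear_eqI[of _ _ p])
  fix u
  show "left_act x (word u * q) = left_act x (word u) * q + word u * left_act x q"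
  proof (rule tensor_linear_eqI[of _ _ q])
    fix v
    show "left_act x (word u * word v) = left_act x (word u) * word v + word u * left_act x (word v)"
      by (simp add: left_act_def left_act_word_append flip: word_append)
  qed (unfold left_act_def, (intro tensor_linear_intros)+)
qed (unfold left_act_def, (intro tensor_linear_intros)+)

text \<open>A derivation kills the unit. The fact is needed because signs are ring factors, to which
  the product rule also applies.\<close>

lemma left_act_power_minus_one: "left_act x ((-1) ^ k :: 'v list \<Rightarrow>\<^sub>0 'k::field) = 0"
  using left_act_mult[of x 1 "1 :: 'v list \<Rightarrow>\<^sub>0 'k"]
    tensor_linear_sign[OF tensor_linear_left_act, of x k "1 :: 'v list \<Rightarrow>\<^sub>0 'k"] by simp

lemma word_act_mult: "word_act w (p * q) = word_act w p * q + p * word_act w q"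
  by (simp add: word_act_def left_act_mult)

lemma word_act_power_minus_one: "word_act w ((-1) ^ k :: 'v list \<Rightarrow>\<^sub>0 'k::field) = 0"
  by (simp add: word_act_def left_act_power_minus_one)

lemma word_act_even: "even (length w) \<Longrightarrow> word_act w p = 0"
  by (auto simp: word_act_def)

lemma tensor_linear_word_act:
  "tensor_linear (word_act w :: ('v list \<Rightarrow>\<^sub>0 'k::field) \<Rightarrow> _)"
proof (cases "length w = 1")
  case True
  then have "(word_act w :: ('v list \<Rightarrow>\<^sub>0 'k) \<Rightarrow> _) = left_act (hd w)" by (simp add: word_act_def fun_eq_iff)
  then show ?thesis by (simp add: tensor_linear_left_act)
next
  case False
  then have "(word_act w :: ('v list \<Rightarrow>\<^sub>0 'k) \<Rightarrow> _) = (\<lambda>_. 0)" by (simp add: word_act_def fun_eq_iff)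
  then show ?thesis by (simp add: tensor_linear_zero)
qed

lemmas word_act_rules = tensor_linear_rules[OF tensor_linear_word_act]

lemma of_length_left_act_word: "of_length (length w) (left_act_word x w :: 'v list \<Rightarrow>\<^sub>0 'k::field)"
  by (induction w) (simp_all add: of_length_0 of_length_add of_length_word of_length_letter_mult)

text \<open>Truncated subtraction is harmless: on at most one letter \<open>boundary\<close> is
  zero, and zero is homogeneous of every degree.\<close>

lemma of_length_boundary: "of_length (length w - 1) (boundary w :: 'v list \<Rightarrow>\<^sub>0 'k::field)"
proof (induction w)
  case (Cons y w)
  show ?case
  proof (cases "w = []")
    case False
    then obtain k where k: "length w = Suc k" by (cases w) auto
    have "of_length (length w) (word_act w (word [y]) :: 'v list \<Rightarrow>\<^sub>0 'k)"
      by (auto simp: word_act_def left_act_def of_length_0 intro!: of_length_add of_length_word)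
    with False Cons show ?thesis
      using of_length_letter_mult[of k "boundary w :: 'v list \<Rightarrow>\<^sub>0 'k" y]
        of_length_left_act_word[of w y, where 'k = 'k]
      by (simp add: k of_length_add of_length_diff)
  qed (simp add: of_length_0)
qed (simp add: of_length_0)

section \<open>The operator \<open>E = D \<circ> b\<close> on Lie elements\<close>

text \<open>An even derivation of the tensor algebra is also a derivation of the graded commutator,
  from which \<open>eps\<close> is built.\<close>

lemma extend_eps_left_act_word: 
  "extend eps (left_act_word x w) = left_act x (eps w :: 'v list \<Rightarrow>\<^sub>0 'k::field)"
proof (induction w)
  case (Cons y w)
  show ?case
  proof (cases "w = []")
    case True
    then show ?thesis by (simp add: left_act_def extend_rules)
  next
    case False
    have [simp]: "left_act x (word [y]) = (word [br x y] :: 'v list \<Rightarrow>\<^sub>0 'k)" by (simp add: left_act_def)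
    have "length w > 0" using False by simp
    from extend_eps_letter_mult[OF of_length_left_act_word[of w x, where 'k = 'k] this, of y] show ?thesis
      using False Cons
      by (simp add: extend_rules eps_Cons left_act_mult left_act_rules
          left_act_power_minus_one algebra_simps)
  qed
qed (simp add: extend_rules left_act_rules)

text \<open>Since \<open>boundary w\<close> has degree \<open>length w - 1\<close>, its graded
  commutator with \<open>y\<close> carries the sign opposite to the one in
  \<open>eps_Cons\<close>.\<close>

lemma eps_boundary_Cons:
  assumes "w \<noteq> []"
  shows "eps_boundary (y # w) = left_act y (eps w) -
    (word [y] * eps_boundary w + (-1) ^ length w * (eps_boundary w * word [y])) +
    (word_act w (word [y]) :: 'v list \<Rightarrow>\<^sub>0 'k::field)"
proof -
  \<comment> \<open>When nonzero, the argument is a single letter, which D fixes.\<close>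
  have "extend eps (word_act w (word [y])) = (word_act w (word [y]) :: 'v list \<Rightarrow>\<^sub>0 'k)"
    by (simp add: word_act_def left_act_def extend_rules)
  moreover have "extend eps (word [y] * boundary w) =
    word [y] * eps_boundary w + (-1) ^ length w * (eps_boundary w * (word [y] :: 'v list \<Rightarrow>\<^sub>0 'k))"
  \<comment> \<open>For a letter \<open>w\<close> the degree of \<open>boundary w\<close> is 0,
    outside the range of \<open>extend_eps_letter_mult\<close>, but \<open>boundary w\<close> is
    zero.\<close>
  proof (cases "length w = 1")
    case True
    then have "(boundary w :: 'v list \<Rightarrow>\<^sub>0 'k) = 0" by (auto simp: length_Suc_conv)
    then show ?thesis by (simp add: eps_boundary_def extend_rules)
  next
    case False
    with assms obtain k where "length w = Suc (Suc k)"
      by (metis One_nat_def length_0_conv not0_implies_Suc)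
    then show ?thesis
      using extend_eps_letter_mult[OF of_length_boundary[of w, where 'k = 'k], of y]
      by (simp add: eps_boundary_def)
  qed
  ultimately show ?thesis
    using assms by (simp add: eps_boundary_def extend_rules extend_eps_left_act_word)
qed

lemma eps_boundary_singleton: "eps_boundary [y] = 0"
  by (simp add: eps_boundary_def extend_rules)

lemma extend_eps_boundary_letter_mult:
  assumes "of_length k p" "k > 0"
  shows "extend eps_boundary (word [y] * p) = left_act y (extend eps p) -
    (word [y] * extend eps_boundary p + (-1) ^ k * (extend eps_boundary p * word [y])) +
    (extend (\<lambda>w. word_act w (word [y])) p :: 'v list \<Rightarrow>\<^sub>0 'k::field)"
proof (rule tensor_linear_eqI[of _ _ p])
  fix w assume "w \<in> Poly_Mapping.keys p"
  with assms have "length w = k" by (auto simp: of_length_def)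
  moreover from this assms have "w \<noteq> []" by auto
  ultimately show "extend eps_boundary (word [y] * word w) = left_act y (extend eps (word w)) -
    (word [y] * extend eps_boundary (word w) + (-1) ^ k * (extend eps_boundary (word w) * word [y])) +
    (extend (\<lambda>w. word_act w (word [y])) (word w) :: 'v list \<Rightarrow>\<^sub>0 'k)"
    by (simp add: eps_boundary_Cons flip: word_Cons)
qed (unfold left_act_def, (intro tensor_linear_intros)+)

lemma extend_word_act_eq_0:
  assumes "of_length k p" "k > 1"
  shows "extend (\<lambda>w. word_act w q) p = 0"
  by (rule tensor_linear_eqI[of _ "\<lambda>_. 0"])
     (use assms in \<open>auto intro: tensor_linear_intros simp: of_length_def word_act_def\<close>)

text \<open>The second order identity for \<open>\<delta>\<close>; \<open>v\<close> has to vary in the induction, since \<open>D (y w) \<otimes> v\<close> produces \<open>D w \<otimes> (y v)\<close>.\<close>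

lemma eps_boundary_mult:
  assumes "w \<noteq> []" "v \<noteq> []"
  shows "extend eps_boundary (eps w * word v) =
    (eps_boundary w * eps v - (-1) ^ ((length w + 1) * length v) * (eps v * eps_boundary w)) +
    (-1) ^ length w *
      (eps w * eps_boundary v - (-1) ^ (length w * (length v + 1)) * (eps_boundary v * eps w)) +
    (word_act w (eps v) - (-1) ^ (length w * length v) * (word_act v (eps w) :: 'v list \<Rightarrow>\<^sub>0 'k::field))"
  using assms
proof (induction w arbitrary: v)
  case (Cons y w)
  show ?case
  proof (cases "w = []")
    case True
    \<comment> \<open>For a letter the claim is \<open>eps_boundary_Cons\<close>:
      \<open>eps_boundary [y]\<close> vanishes, and \<open>word_act v\<close> has the right sign in
      its only nonzero case, \<open>length v = 1\<close>.\<close>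
    have "extend eps_boundary (eps [y] * word v) = (eps_boundary (y # v) :: 'v list \<Rightarrow>\<^sub>0 'k)"
      by (simp flip: word_Cons)
    with True Cons.prems show ?thesis
      by (cases "length v = 1"; cases "even (length v)")
        (auto simp: eps_boundary_Cons eps_boundary_singleton word_act_def algebra_simps)
  next
    case False
    have len: "of_length (length w + length v) (eps w * word v :: 'v list \<Rightarrow>\<^sub>0 'k)"
      by (intro of_length_mult of_length_eps of_length_word refl)
    have lens: "0 < length w" "0 < length v" using False Cons.prems by auto
    then have len_gt: "length w + length v > 1" by linarith
    \<comment> \<open>The \<open>word_act\<close> term of the letter rule vanishes, as
      \<open>eps w * word v\<close> has degree at least two; D maps this tensor to the bracket of
      \<open>D w\<close> and \<open>D v\<close>.\<close>
    have 1: "extend eps_boundary (word [y] * (eps w * word v)) =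
        left_act y (eps w * eps v - (-1) ^ (length w * length v) * (eps v * eps w)) -
        (word [y] * extend eps_boundary (eps w * word v) +
         (-1) ^ (length w + length v) * (extend eps_boundary (eps w * word v) * (word [y] :: 'v list \<Rightarrow>\<^sub>0 'k)))"
      using lens by (simp add: extend_eps_boundary_letter_mult[OF len]
          extend_word_act_eq_0[OF len len_gt] extend_eps_mult_word[OF False Cons.prems(2)])
    have 2: "word_act (y # w) p = 0" "word_act (y # v) p = 0" for p :: "'v list \<Rightarrow>\<^sub>0 'k"
      using lens by (simp_all add: word_act_def)
    have 3: "extend eps_boundary (eps (y # w) * word v) =
      extend eps_boundary (word [y] * (eps w * word v)) -
        (-1) ^ length w * extend eps_boundary (eps w * word (y # v) :: 'v list \<Rightarrow>\<^sub>0 'k)"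
      using False by (simp add: eps_Cons left_diff_distrib extend_rules word_Cons[of y v] mult.assoc)
    \<comment> \<open>The induction hypothesis enters for \<open>v\<close> and for
      \<open>y # v\<close>; the rest is expansion by the product rules and cancellation, parity by
      parity.\<close>
    show ?thesis
      unfolding 3 1 Cons.IH[OF False Cons.prems(2)] Cons.IH[OF False list.distinct(2)]
      using False Cons.prems
      by (cases "even (length w)"; cases "even (length v)")
         (simp_all add: 2 word_act_even eps_boundary_Cons eps_Cons left_act_mult left_act_rules
            word_act_mult word_act_rules
            left_act_power_minus_one word_act_power_minus_one algebra_simps)
  qed
qed simp

text \<open>For \<open>y # w\<close> with \<open>m = length w > 0\<close>, the half
  \<open>y \<otimes> D w\<close> gives \<open>m\<close> copies of the main terms of
  \<open>eps_boundary_Cons\<close>, and the half \<open>D w \<otimes> y\<close> one more by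
  \<open>eps_boundary_mult\<close>. The term \<open>word_act w (word [y])\<close> arises twice,
  which agrees with \<open>m + 1\<close> since it is zero unless \<open>m = 1\<close>.\<close>

lemma eps_boundary_eps:
  "extend eps_boundary (eps w) = of_nat (length w) * (eps_boundary w :: 'v list \<Rightarrow>\<^sub>0 'k::field)"
proof (cases w)
  case (Cons y v)
  show ?thesis
    unfolding Cons
  proof (induction v arbitrary: y)
    case Nil
    then show ?case by (simp add: eps_boundary_singleton)
  next
    case (Cons z u)
    define w where "w = z # u"
    have w: "w \<noteq> []" "0 < length w" by (simp_all add: w_def)
    have comm: "a * (of_nat (length w) * p) = of_nat (length w) * (a * p)" for a p :: "'v list \<Rightarrow>\<^sub>0 'k"
      by (metis mult.assoc mult_of_nat_commute)
    have act: "extend (\<lambda>v. word_act v (word [y])) (eps w) = (word_act w (word [y]) :: 'v list \<Rightarrow>\<^sub>0 'k)"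
    proof (cases "length w = 1")
      case True
      then show ?thesis by (auto simp: length_Suc_conv)
    next
      case False
      then show ?thesis
        using extend_word_act_eq_0[OF of_length_eps, of w] w by (simp add: word_act_def)
    qed
    have IH: "extend eps_boundary (eps w) = of_nat (length w) * (eps_boundary w :: 'v list \<Rightarrow>\<^sub>0 'k)"
      unfolding w_def by (rule Cons.IH)
    have sgn: "(-1) ^ length w * word_act w p = - word_act w p" for p :: "'v list \<Rightarrow>\<^sub>0 'k"
      by (simp add: word_act_def)
    have act1: "word_act [y] p = left_act y p" for p :: "'v list \<Rightarrow>\<^sub>0 'k"
      by (simp add: word_act_def)
    have "extend eps_boundary (eps (y # w) :: 'v list \<Rightarrow>\<^sub>0 'k) =
        extend eps_boundary (word [y] * eps w) -
        (-1) ^ length w * extend eps_boundary (eps w * word [y])"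
      by (simp add: eps_Cons w extend_rules)
    also have "\<dots> = of_nat (length (y # w)) * eps_boundary (y # w)"
      unfolding extend_eps_boundary_letter_mult[OF of_length_eps w(2)] act IH
        eps_boundary_mult[OF w(1) list.distinct(2)] eps_boundary_Cons[OF w(1)]
      using sgn[of "word [y]"]
      by (cases "length w = 1"; cases "even (length w)")
         (auto simp add: extend_eps_eps eps_boundary_singleton act1 left_act_rules
            comm word_act_def mult_2 algebra_simps)
    finally show ?case by (simp add: w_def)
  qed
qed (simp add: eps_boundary_def extend_rules)

section \<open>Duality between \<open>boundary\<close> and the coboundary\<close>

lemma apply_tensor_left_act_word:
  "apply_tensor A (left_act_word x w) = (\<Sum>j<length w. A (w[j := br x (w ! j)]))"
proof (induction w arbitrary: A)
  case Nil
  then show ?case by (simp add: apply_tensor_def)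
next
  case (Cons y w)
  then show ?case
    by (simp add: apply_tensor_add apply_tensor_single apply_tensor_letter_mult
        sum.lessThan_Suc_shift del: sum.lessThan_Suc)
qed

text \<open>\<open>(n + 1) A (b D w) = A (D b D w) = (n + 2) A (D b w) = (n + 1) (n + 2) A (b
  w)\<close>: anti-cyclicity at both ends, \<open>eps_boundary_eps\<close> in the middle. In
  characteristic 0 the factor \<open>n + 1\<close> cancels.\<close>

lemma apply_tensor_boundary_eps:
  fixes A :: "'v list \<Rightarrow> 'k::field_char_0"
  assumes anticyclic: "\<And>u. length u = n + 1 \<Longrightarrow> apply_tensor A (eps u) = of_nat (n + 1) * A u"
    and len: "length w = n + 2"
  shows "apply_tensor A (extend boundary (eps w)) = of_nat (n + 2) * apply_tensor A (boundary w)"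
proof -
  \<comment> \<open>Anti-cyclicity, extended linearly from words to homogeneous tensors.\<close>
  have eps: "apply_tensor A (extend eps p) = of_nat (n + 1) * apply_tensor A p"
    if "of_length (n + 1) p" for p
  proof -
    have "apply_tensor (\<lambda>u. apply_tensor A (eps u)) p = apply_tensor (\<lambda>u. of_nat (n + 1) * A u) p"
      unfolding apply_tensor_def[of _ p] using that anticyclic
      by (intro sum.cong refl) (simp add: of_length_def)
    then show ?thesis
      by (simp only: apply_tensor_extend)
         (simp add: apply_tensor_def sum_distrib_left mult.left_commute)
  qed
  have len_boundary: "of_length (n + 1) (boundary u :: 'v list \<Rightarrow>\<^sub>0 'k)" if "length u = n + 2" for u
    using of_length_boundary[of u, where 'k = 'k] that by simp
  have len_eps: "of_length (n + 2) (eps w :: 'v list \<Rightarrow>\<^sub>0 'k)"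
    using of_length_eps[of w, where 'k = 'k] len by simp
  have "of_nat (n + 1) * apply_tensor A (extend boundary (eps w)) =
      apply_tensor A (extend eps (extend boundary (eps w)))"
    by (intro eps[symmetric] of_length_extend[OF len_eps] len_boundary)
  also have "extend eps (extend boundary (eps w)) = extend eps_boundary (eps w :: 'v list \<Rightarrow>\<^sub>0 'k)"
    unfolding extend_extend eps_boundary_def ..
  also have "\<dots> = of_nat (n + 2) * extend eps (boundary w)"
    by (simp only: eps_boundary_eps len eps_boundary_def)
  also have "apply_tensor A \<dots> = of_nat (n + 1) * (of_nat (n + 2) * apply_tensor A (boundary w))"
    by (simp only: apply_tensor_of_nat eps[OF len_boundary[OF len]] mult.left_commute)
  finally show ?thesis
    by (simp add: of_nat_neq_0 del: of_nat_Suc of_nat_add)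
qed

end

lemma b_LP_0: "b_LP br 0 A [x, y] = A [br x y + br y x]"
  by (simp add: b_LP_def)

text \<open>The terms in which \<open>x\<close> acts form the sum. In all others \<open>x\<close>
  stays in front, and lowering \<open>i\<close> and the degree by one flips the sign.\<close>

lemma b_LP_Suc:
  assumes "length w = n + 2"
  shows "b_LP br (Suc n) A (x # w) =
    (\<Sum>j<length w. A (w[j := br x (w ! j)])) - b_LP br n (\<lambda>u. A (x # u)) w"
proof -
  \<comment> \<open>Removing the first entry shifts \<open>j\<close> by one; the form
    \<open>{i..}\<close> serves both \<open>i = 0\<close> and \<open>Suc i\<close>.\<close>
  have reindex: "(\<Sum>j\<in>{i<..<Suc m}. f j) = (\<Sum>j\<in>{..<m} \<inter> {i..}. f (Suc j))"
    for i m and f :: "nat \<Rightarrow> 'k::field"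
  proof -
    have "{i<..<Suc m} = Suc ` ({..<m} \<inter> {i..})"
      by (auto simp: image_iff Bex_def) presburger
    then show ?thesis by (simp add: sum.reindex)
  qed
  have "{..<m} \<inter> {0..} = {..<m}" "{..<m} \<inter> {Suc i..} = {i<..<m}" for i m :: nat
    by auto
  then show ?thesis
    using assms
    by (simp add: b_LP_def sum.lessThan_Suc_shift reindex omit_def sum_negf
        sum_distrib_left algebra_simps del: sum.lessThan_Suc)
qed

text \<open>On two letters \<open>boundary\<close> is a sum of two words, while \<open>b_LP\<close>
  applies \<open>A\<close> to the one vector \<open>br x y + br y x\<close>; hence additivity in the
  last slot. Longer words reduce to this by fixing the first argument.\<close>

lemma apply_tensor_boundary:
  fixes br :: "'v::ab_group_add \<Rightarrow> 'v \<Rightarrow> 'v" and A :: "'v list \<Rightarrow> 'k::field"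
  assumes "length w = n + 2"
    and "\<And>u a b. length u = n \<Longrightarrow> A (u @ [a + b]) = A (u @ [a]) + A (u @ [b])"
  shows "apply_tensor A (boundary br w) = b_LP br n A w"
  using assms
proof (induction n arbitrary: A w)
  case 0
  then obtain x y where "w = [x, y]" by (auto simp: length_Suc_conv numeral_2_eq_2)
  with 0 show ?case
    by (simp add: b_LP_0 word_act_def left_act_def apply_tensor_add apply_tensor_single)
next
  case (Suc n)
  then obtain x v where w: "w = x # v" and v: "length v = n + 2" by (cases w) auto
  have "apply_tensor (\<lambda>u. A (x # u)) (boundary br v) = b_LP br n (\<lambda>u. A (x # u)) v"
    using Suc.prems(2)[of "x # _"] by (intro Suc.IH v) simp
  moreover have "word_act br v p = 0" "v \<noteq> []" for p :: "'v list \<Rightarrow>\<^sub>0 'k"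
    using v by (auto simp: word_act_def)
  ultimately show ?case
    using v by (simp add: w b_LP_Suc apply_tensor_diff apply_tensor_left_act_word
        apply_tensor_letter_mult)
qed

section \<open>Multilinearity of the coboundary\<close>

text \<open>Indexed by the number of arguments, so that fixing the first one lowers the index by
  one.\<close>

definition multilinear :: "('k::field \<Rightarrow> 'v::ab_group_add \<Rightarrow> 'v) \<Rightarrow> nat \<Rightarrow> ('v list \<Rightarrow> 'k) \<Rightarrow> bool" where
  "multilinear scale m A \<longleftrightarrow>
     (\<forall>xs i. length xs = m \<longrightarrow> i < m \<longrightarrow> Vector_Spaces.linear scale (*) (\<lambda>v. A (xs[i := v])))"

lemma multilinear_Cons:
  fixes A :: "'v::ab_group_add list \<Rightarrow> 'k::field"
  assumes "multilinear scale (Suc m) A"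
  shows "multilinear scale m (\<lambda>u. A (x # u))"
  unfolding multilinear_def
proof (intro allI impI)
  fix xs :: "'v list" and i
  assume "length xs = m" "i < m"
  then show "Vector_Spaces.linear scale (*) (\<lambda>v. A (x # xs[i := v]))"
    using assms[unfolded multilinear_def, rule_format, of "x # xs" "Suc i"] by simp
qed

context leibniz_algebra
begin

lemma linear_to_field_iff:
  "Vector_Spaces.linear scale (*) f \<longleftrightarrow>
     (\<forall>a b. f (a + b) = f a + f b) \<and> (\<forall>c a. f (scale c a) = c * f a)"
proof -
  have "vector_space ((*) :: 'k \<Rightarrow> 'k \<Rightarrow> 'k)"
    by unfold_locales (simp_all add: algebra_simps)
  then show ?thesis
    unfolding Vector_Spaces.linear_iff using vector_space_axioms by blast
qed

lemma multilinear_iff: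
  "multilinear scale m A \<longleftrightarrow>
     (\<forall>xs i. length xs = m \<longrightarrow> i < m \<longrightarrow>
        (\<forall>a b. A (xs[i := a + b]) = A (xs[i := a]) + A (xs[i := b])) \<and>
        (\<forall>c a. A (xs[i := scale c a]) = c * A (xs[i := a])))"
  by (simp add: multilinear_def linear_to_field_iff)

lemma br_linear:
  "br (a + b) y = br a y + br b y" "br (scale c a) y = scale c (br a y)"
  "br x (a + b) = br x a + br x b" "br x (scale c a) = scale c (br x a)"
  using linear_left linear_right by (simp_all add: Vector_Spaces.linear_iff)

lemma multilinear_b_LP:
  assumes "multilinear scale (n + 1) A"
  shows "multilinear scale (n + 2) (b_LP br n A)"
  using assms
proof (induction n arbitrary: A)
  case 0
  then have lin: "A [a + b] = A [a] + A [b]" "A [scale c a] = c * A [a]" for a b c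
    by (auto simp: multilinear_iff dest!: spec[of _ "[0]"])
  show ?case
    unfolding multilinear_iff
  proof (intro allI impI)
    fix xs :: "'v list" and i :: nat
    assume "length xs = 0 + 2" "i < 0 + 2"
    then obtain x y where "xs = [x, y]"
      by (auto simp: length_Suc_conv numeral_2_eq_2)
    moreover have "i = 0 \<or> i = 1" using \<open>i < 0 + 2\<close> by auto
    ultimately show "(\<forall>a b. b_LP br 0 A (xs[i := a + b]) = b_LP br 0 A (xs[i := a]) + b_LP br 0 A (xs[i := b])) \<and>
        (\<forall>c a. b_LP br 0 A (xs[i := scale c a]) = c * b_LP br 0 A (xs[i := a]))"
      by (auto simp: b_LP_0 br_linear lin algebra_simps)
  qed
next
  case (Suc n)
  have A: "A (xs[i := a + b]) = A (xs[i := a]) + A (xs[i := b])"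
    "A (xs[i := scale c a]) = c * A (xs[i := a])"
    if "length xs = n + 2" "i < n + 2" for xs i a b c
    using Suc.prems that by (auto simp: multilinear_iff)
  have A0: "A ((a + b) # w) = A (a # w) + A (b # w)" "A (scale c a # w) = c * A (a # w)"
    if "length w = n + 1" for w a b c
    using A[of "a # w" 0] that by simp_all
  have IH: "multilinear scale (n + 2) (b_LP br n (\<lambda>u. A (x # u)))" for x
    using Suc.prems by (intro Suc.IH multilinear_Cons) simp
  show ?case
    unfolding multilinear_iff
  proof (intro allI impI)
    fix xs :: "'v list" and i :: nat
    assume xs: "length xs = Suc n + 2" and i: "i < Suc n + 2"
    then obtain x w where xs_eq: "xs = x # w" and w: "length w = n + 2" by (cases xs) auto
    show "(\<forall>a b. b_LP br (Suc n) A (xs[i := a + b]) =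
          b_LP br (Suc n) A (xs[i := a]) + b_LP br (Suc n) A (xs[i := b])) \<and>
        (\<forall>c a. b_LP br (Suc n) A (xs[i := scale c a]) = c * b_LP br (Suc n) A (xs[i := a]))"
    proof (cases i)
      case 0
      \<comment> \<open>In the recursive part the first argument only fixes a slot of
        \<open>A\<close>, and \<open>b_LP\<close> is linear in the cochain.\<close>
      have "b_LP br n (\<lambda>u. A ((a + b) # u)) w = b_LP br n (\<lambda>u. A (a # u)) w + b_LP br n (\<lambda>u. A (b # u)) w"
        "b_LP br n (\<lambda>u. A (scale c a # u)) w = c * b_LP br n (\<lambda>u. A (a # u)) w" for a b c
        using w by (simp_all add: b_LP_def A0 omit_def sum.distrib sum_distrib_left algebra_simps)
      with 0 w show ?thesis
        by (simp add: xs_eq b_LP_Suc br_linear A sum.distrib sum_distrib_left algebra_simps)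
    next
      case (Suc k)
      with i have k: "k < n + 2" by simp
      \<comment> \<open>For \<open>j = k\<close> the varying entry sits inside the bracket; for
        \<open>j \<noteq> k\<close> the updates commute and \<open>A\<close> is linear in slot
        \<open>k\<close>.\<close>
      have "A (w[k := a + b, j := br x (w[k := a + b] ! j)]) =
          A (w[k := a, j := br x (w[k := a] ! j)]) + A (w[k := b, j := br x (w[k := b] ! j)])"
        "A (w[k := scale c a, j := br x (w[k := scale c a] ! j)]) =
          c * A (w[k := a, j := br x (w[k := a] ! j)])" if "j < n + 2" for a b c j
        using w k that
        by (cases "j = k"; simp add: br_linear A list_update_swap[of k j])+
      moreover have "b_LP br n (\<lambda>u. A (x # u)) (w[k := a + b]) =
          b_LP br n (\<lambda>u. A (x # u)) (w[k := a]) + b_LP br n (\<lambda>u. A (x # u)) (w[k := b])"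
        "b_LP br n (\<lambda>u. A (x # u)) (w[k := scale c a]) = c * b_LP br n (\<lambda>u. A (x # u)) (w[k := a])"
        for a b c
        using IH[of x] w k by (simp_all add: multilinear_iff)
      ultimately show ?thesis
        using Suc w
        by (simp add: xs_eq b_LP_Suc sum.distrib sum_distrib_left algebra_simps)
    qed
  qed
qed

end

section \<open>Anti-cyclicity of the coboundary\<close>

theorem theorem4p6:
  fixes scale :: "'k::field_char_0 \<Rightarrow> 'v::ab_group_add \<Rightarrow> 'v"
    and br :: "'v \<Rightarrow> 'v \<Rightarrow> 'v"
  assumes "leibniz_algebra scale br"
  shows "\<forall>n. b_LP br n ` ALP scale n \<subseteq> ALP scale (n + 1)"
proof (intro allI subsetI, elim imageE)
  fix n and A B :: "'v list \<Rightarrow> 'k"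
  assume A: "A \<in> ALP scale n" and B: "B = b_LP br n A"
  interpret leibniz_algebra scale br by fact
  have ml: "multilinear scale (n + 1) A"
    using A unfolding ALP_def LP_def multilinear_def by blast
  have anticyclic: "apply_tensor A (eps u) = of_nat (n + 1) * A u" if "length u = n + 1" for u
  proof -
    have "A u = 1 / of_nat (n + 1) * apply_tensor A (eps u)"
      using A that by (simp add: ALP_def)
    then show ?thesis by (simp add: of_nat_neq_0 del: of_nat_Suc of_nat_add)
  qed
  have boundary: "apply_tensor A (boundary br w) = B w" if "length w = n + 2" for w
    unfolding B
  proof (rule apply_tensor_boundary[OF that])
    fix u :: "'v list" and a b
    assume "length u = n"
    then show "A (u @ [a + b]) = A (u @ [a]) + A (u @ [b])"
      using ml[unfolded multilinear_iff, rule_format, of "u @ [a]" n]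
      by (simp add: list_update_append)
  qed
  have "apply_tensor B (eps w) = of_nat (n + 2) * B w" if w: "length w = n + 2" for w
  proof -
    \<comment> \<open>Duality is applied to each word of \<open>eps w\<close>, all of which have
      length \<open>n + 2\<close>.\<close>
    have "apply_tensor B (eps w) = apply_tensor (\<lambda>u. apply_tensor A (boundary br u)) (eps w)"
      unfolding apply_tensor_def[of _ "eps w"] using of_length_eps[of w, where 'k = 'k] w
      by (intro sum.cong refl) (simp add: of_length_def boundary)
    also have "\<dots> = of_nat (n + 2) * B w"
      using apply_tensor_boundary_eps[OF anticyclic w, of br] boundary[OF w]
      by (simp only: apply_tensor_extend)
    finally show ?thesis .
  qed
  then have "B w = 1 / of_nat (n + 1 + 1) * apply_tensor B (eps w)" if "length w = n + 1 + 1" for w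
    using that by (simp add: of_nat_neq_0 del: of_nat_Suc of_nat_add)
  moreover have "B \<in> LP scale (n + 1)"
    using multilinear_b_LP[OF ml] by (simp add: LP_def multilinear_def B b_LP_def)
  ultimately show "B \<in> ALP scale (n + 1)"
    by (simp add: ALP_def)
qed

end
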